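(* Let $q$ be an odd prime power, let $\varepsilon\in\mathbb{F}_q$ be such that $1+\varepsilon^2$ is a non-square in $\mathbb{F}_q$, and let $m\ge 4$ be an even integer. Then the number of ordered $m$-tuples $(y_1,\ldots,y_m)\in\mathbb{F}_q^m$ such that both $$y_1^2+y_2^2+\cdots+y_m^2\in \Box\cup\{0\}$$ and $$(y_1-1)^2+(y_2-\varepsilon)^2+y_3^2+\cdots+y_m^2\in\Box\cup\{0\}$$ hold is equal to $$\mu=\begin{cases}\frac14 q^{m/2-1}(q+1)\left(q^{m/2}+q^{m/2-1}+2\right) & \text{if } q\equiv 1 \pmod 4,\\ \frac14 q^{m/2-1}(q+1)\left(q^{m/2}+q^{m/2-1}+2(-1)^{m/2}\right) & \text{if } q\equiv 3 \pmod 4.\end{cases}$$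
   Context: $\mathbb{F}_q$ is the finite field of odd order $q$; $\Box$ denotes the set of non-zero squares of $\mathbb{F}_q$. *)

theory Defs
  imports Complex_Main "HOL-Library.FuncSet" "HOL-Library.Cardinality"
begin

definition nonzero_squares :: "'a::field set" where
  "nonzero_squares = {x^2 | x. x \<noteq> 0}"

end

theory Submission
  imports Defs
begin

text \<open>Let \<open>\<chi>\<close> be the quadratic character and \<open>d = 1 + \<epsilon>\<^sup>2\<close>. A sum over \<open>2 k\<close> free coordinates
  of a function of the sum of squares is a combination of the total sum of the function and its
  value at zero, so everything reduces to the first two coordinates. There, a rotation turns the
  distribution of the two norms \<open>a, b\<close> into
  \<open>1 + \<chi>(-1) \<chi>((a + d - b)\<^sup>2 - 4 d a)\<close>. For \<open>a = x\<^sup>2\<close> and \<open>b = z\<^sup>2\<close> Heron's identity factors the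
  argument as \<open>((x + z)\<^sup>2 - d) ((x - z)\<^sup>2 - d)\<close>, so that the double character sum is the square of
  \<open>\<Sum>u. \<chi>(u\<^sup>2 - d) = -1\<close>.\<close>

section \<open>Fixed-point-free involutions and odd characteristic\<close>

lemma even_card_involution:
  assumes "finite A" "\<And>x. x \<in> A \<Longrightarrow> f x \<in> A \<and> f (f x) = x \<and> f x \<noteq> x"
  shows "even (card A)"
  using assms
proof (induction A rule: finite_psubset_induct)
  case (psubset A)
  show ?case
  proof (cases "A = {}")
    case False
    then obtain a where a: "a \<in> A" by blast
    let ?B = "A - {a, f a}"
    have fa: "f a \<in> A" "f (f a) = a" "f a \<noteq> a" using psubset.prems[OF a] by auto
    have "even (card ?B)"
    proof (rule psubset.IH)
      show "?B \<subset> A" using a by blast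
      show "f x \<in> ?B \<and> f (f x) = x \<and> f x \<noteq> x" if "x \<in> ?B" for x
        using psubset.prems[of x] fa that by auto
    qed
    moreover have "card ?B = card A - 2"
      using a fa psubset.hyps by (subst card_Diff_subset) auto
    moreover have "card {a, f a} \<le> card A"
      using a fa psubset.hyps by (intro card_mono) auto
    ultimately show ?thesis using fa by auto
  qed auto
qed

text \<open>If 2 = 0, the translation by 1 pairs off the elements of the field, which would make its
  order even.\<close>

lemma two_neq_zero_if_odd_card:
  assumes "odd CARD('a::{field,finite})"
  shows "(2::'a) \<noteq> 0"
proof
  assume two: "(2::'a) = 0"
  have "even (card (UNIV :: 'a set))"
  proof (rule even_card_involution[where f = "\<lambda>x. x + 1"])
    fix x :: 'a
    have "x + 1 + 1 = x + 2" by (simp add: add.assoc)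
    then show "x + 1 \<in> UNIV \<and> x + 1 + 1 = x \<and> x + 1 \<noteq> x"
      using two by simp
  qed auto
  then show False using assms by simp
qed

section \<open>The quadratic character and its sum over u^2 - d\<close>

definition quad_char :: "'a::field \<Rightarrow> real" where
  "quad_char x = (if x = 0 then 0 else if x \<in> nonzero_squares then 1 else -1)"

lemma quad_char_0 [simp]: "quad_char 0 = 0"
  by (simp add: quad_char_def)

lemma quad_char_square: "x \<noteq> 0 \<Longrightarrow> quad_char (x^2) = 1"
  by (auto simp: quad_char_def nonzero_squares_def)

lemma card_square_roots:
  fixes c :: "'a::{field,finite}"
  assumes two: "(2::'a) \<noteq> 0"
  shows "real (card {x. x^2 = c}) = 1 + quad_char c"
proof -
  consider "c = 0" | w where "c = w^2" "w \<noteq> 0" | "c \<noteq> 0" "c \<notin> nonzero_squares"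
    by (auto simp: nonzero_squares_def)
  then show ?thesis
  proof cases
    case 1
    then have "{x. x^2 = c} = {0}" by auto
    then show ?thesis using 1 by simp
  next
    case 2
    have "w \<noteq> - w"
    proof
      assume "w = - w"
      then have "2 * w = 0" by (metis add.right_inverse mult_2)
      then show False using two 2 by simp
    qed
    moreover have "{x. x^2 = c} = {w, - w}" using 2 by (auto simp: power2_eq_iff)
    ultimately show ?thesis using 2 by (simp add: quad_char_square)
  next
    case 3
    then have "{x. x^2 = c} = {}" by (auto simp: nonzero_squares_def)
    then show ?thesis using 3 by (simp add: quad_char_def)
  qed
qed

text \<open>Group x by its square c: the fibre over c has \<open>1 + quad_char c\<close> elements.
  This converts sums over coordinates into character sums throughout.\<close>

lemma sum_squares_eq:
  fixes f :: "'a::{field,finite} \<Rightarrow> real"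
  assumes two: "(2::'a) \<noteq> 0"
  shows "(\<Sum>x\<in>UNIV. f (x^2)) = (\<Sum>c\<in>UNIV. (1 + quad_char c) * f c)"
proof -
  have "(\<Sum>x\<in>UNIV. f (x^2)) = (\<Sum>c\<in>UNIV. \<Sum>x | x \<in> UNIV \<and> x^2 = c. f (x^2))"
    by (rule sum.group[symmetric]) auto
  also have "\<dots> = (\<Sum>c\<in>UNIV. (1 + quad_char c) * f c)"
    by (intro sum.cong refl) (simp add: card_square_roots[OF two])
  finally show ?thesis .
qed

lemma sum_quad_char:
  assumes "(2::'a::{field,finite}) \<noteq> 0"
  shows "(\<Sum>c\<in>(UNIV::'a set). quad_char c) = 0"
  using sum_squares_eq[OF assms, of "\<lambda>_. 1"] by (simp add: sum.distrib)

lemma quad_char_mult_square: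
  assumes "x \<noteq> 0"
  shows "quad_char (x^2 * c) = quad_char c"
proof (cases "c = 0")
  case False
  have "x^2 * c \<in> nonzero_squares \<longleftrightarrow> c \<in> nonzero_squares"
  proof
    assume "x^2 * c \<in> nonzero_squares"
    then obtain y where "x^2 * c = y^2" "y \<noteq> 0" by (auto simp: nonzero_squares_def)
    then have "c = (y / x)^2" "y / x \<noteq> 0"
      using assms by (auto simp: field_simps power2_eq_square)
    then show "c \<in> nonzero_squares" by (auto simp: nonzero_squares_def)
  next
    assume "c \<in> nonzero_squares"
    then obtain y where "c = y^2" "y \<noteq> 0" by (auto simp: nonzero_squares_def)
    then have "x^2 * c = (x * y)^2" "x * y \<noteq> 0"
      using assms by (auto simp: power_mult_distrib)
    then show "x^2 * c \<in> nonzero_squares" unfolding nonzero_squares_def by blast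
  qed
  then show ?thesis using assms by (simp add: quad_char_def)
qed simp

lemma sum_UNIV_affine:
  fixes f :: "'a::{field,finite} \<Rightarrow> 'b::comm_monoid_add"
  assumes "n \<noteq> 0"
  shows "(\<Sum>x\<in>UNIV. f (n * x + k)) = (\<Sum>x\<in>UNIV. f x)"
  by (rule sum.reindex_bij_witness[of _ "\<lambda>x. (x - k) / n" "\<lambda>x. n * x + k"])
    (use assms in auto)

lemma quad_char_mult:
  fixes a b :: "'a::{field,finite}"
  assumes two: "(2::'a) \<noteq> 0"
  shows "quad_char (a * b) = quad_char a * quad_char b"
proof -
  consider "a = 0" | w where "a = w^2" "w \<noteq> 0" | "a \<noteq> 0" "a \<notin> nonzero_squares"
    by (auto simp: nonzero_squares_def)
  then show ?thesis
  proof cases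
    case 2
    then show ?thesis by (simp add: quad_char_mult_square quad_char_square)
  next
    case 3
    \<comment> \<open>The values \<open>\<chi>(c) + \<chi>(a c)\<close> are nonpositive and sum to zero, hence all vanish.\<close>
    let ?h = "\<lambda>c. - (quad_char c + quad_char (a * c))"
    have nonneg: "?h c \<ge> 0" for c
    proof (cases "c \<in> nonzero_squares")
      case True
      then obtain w where w: "c = w^2" "w \<noteq> 0" by (auto simp: nonzero_squares_def)
      then have "quad_char (a * c) = quad_char a"
        using quad_char_mult_square[of w a] by (simp add: mult.commute)
      then show ?thesis using 3 w by (simp add: quad_char_square) (simp add: quad_char_def)
    qed (auto simp: quad_char_def)
    have "(\<Sum>c\<in>UNIV. quad_char c + quad_char (a * c)) = 0"
      using sum_UNIV_affine[of a quad_char 0] 3 sum_quad_char[OF two]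
      by (simp add: sum.distrib)
    then have "(\<Sum>c\<in>UNIV. ?h c) = 0" by (simp only: sum_negf minus_zero)
    then have "?h b = 0"
      using nonneg sum_nonneg_eq_0_iff[of UNIV ?h] finite by blast
    moreover have "quad_char a = -1" using 3 by (simp add: quad_char_def)
    ultimately show ?thesis by simp
  qed simp
qed

text \<open>The sum of 1 + chi(u^2 - d) counts the points of the hyperbola u^2 - w^2 = d. Since (u +
  w) (u - w) = d is nonzero, p = u + w ranges freely over the nonzero elements and determines u - w
  = d / p. Hence there are q - 1 points, and subtracting the q ones leaves -1.\<close>

lemma sum_quad_char_square_diff:
  fixes d :: "'a::{field,finite}"
  assumes two: "(2::'a) \<noteq> 0" and d: "d \<noteq> 0"
  shows "(\<Sum>u\<in>UNIV. quad_char (u^2 - d)) = -1"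
proof -
  have "(\<Sum>u\<in>UNIV. 1 + quad_char (u^2 - d)) = (\<Sum>u\<in>UNIV. real (card {w. w^2 = u^2 - d}))"
    by (simp add: card_square_roots[OF two])
  also have "\<dots> = real (card (SIGMA u:UNIV. {w. w^2 = u^2 - d}))"
    by simp
  also have "card (SIGMA u:UNIV. {w. w^2 = u^2 - d}) = card (UNIV - {0::'a})"
  proof (rule bij_betw_same_card, rule bij_betw_byWitness)
    let ?f = "\<lambda>(u, w). u + w" and ?g = "\<lambda>p. ((p + d / p) / 2, (p - d / p) / 2)"
    have uw: "(u + w) * (u - w) = d" if "w^2 = u^2 - d" for u w
      using that by (simp add: algebra_simps power2_eq_square)
    have "?g (u + w) = (u, w)" if "w^2 = u^2 - d" for u w
    proof -
      have "u + w \<noteq> 0" using uw[OF that] d by auto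
      then have "d / (u + w) = u - w" using uw[OF that] by (simp add: field_simps)
      then show ?thesis using two by (simp add: field_simps)
    qed
    then show "\<forall>z\<in>SIGMA u:UNIV. {w. w^2 = u^2 - d}. ?g (?f z) = z" by auto
    show "\<forall>p\<in>UNIV - {0}. ?f (?g p) = p" using two
      by (auto simp: add_divide_distrib[symmetric])
    show "?f ` (SIGMA u:UNIV. {w. w^2 = u^2 - d}) \<subseteq> UNIV - {0}"
      using uw d by fastforce
    have "((p - d / p) / 2)^2 = ((p + d / p) / 2)^2 - d" if "p \<noteq> 0" for p
    proof -
      \<comment> \<open>With an arbitrary r in place of d / p, the expansion involves no quotient
        other than the halves.\<close>
      have "((p + r) / 2)^2 - ((p - r) / 2)^2 = p * r" for r
      proof -
        have "((p + r) / 2)^2 - ((p - r) / 2)^2 = (4 * (p * r)) / 2^2"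
          by (simp add: power_divide diff_divide_distrib[symmetric])
            (simp add: power2_eq_square algebra_simps)
        moreover have "(4::'a) = 2^2" by simp
        ultimately show ?thesis using two by (metis nonzero_mult_div_cancel_left power_not_zero)
      qed
      from this[of "d / p"] show ?thesis using that by (simp add: algebra_simps)
    qed
    then show "?g ` (UNIV - {0}) \<subseteq> (SIGMA u:UNIV. {w. w^2 = u^2 - d})" by auto
  qed
  also have "real (card (UNIV - {0::'a})) = real CARD('a) - 1"
    by (simp add: card_Diff_singleton of_nat_diff)
  finally show ?thesis by (simp add: sum.distrib)
qed

section \<open>Functions of a sum of an even number of squares\<close>

text \<open>For fixed x, the equation y^2 = c - x^2 has 1 + chi(c - x^2) solutions. Summing over x
  and pulling out s = chi(-1), the hyperbola count shows that c is represented q - s times if it is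
  nonzero, with s q further representations for c = 0.\<close>

lemma sum_two_squares:
  fixes F :: "'a::{field,finite} \<Rightarrow> real"
  assumes two: "(2::'a) \<noteq> 0"
  defines "q \<equiv> real CARD('a)" and "s \<equiv> quad_char (-1 :: 'a)"
  shows "(\<Sum>x\<in>UNIV. \<Sum>y\<in>UNIV. F (x^2 + y^2)) = (q - s) * (\<Sum>c\<in>UNIV. F c) + s * q * F 0"
proof -
  have count: "(\<Sum>x\<in>UNIV. 1 + quad_char (c - x^2)) = q - s + (if c = 0 then s * q else 0)" for c :: 'a
  proof -
    have "quad_char (c - x^2) = s * quad_char (x^2 - c)" for x
      unfolding s_def quad_char_mult[OF two, symmetric] by simp
    then have "(\<Sum>x\<in>UNIV. 1 + quad_char (c - x^2)) = q + s * (\<Sum>x\<in>UNIV. quad_char (x^2 - c))"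
      by (simp add: sum.distrib q_def sum_distrib_left)
    also have "(\<Sum>x\<in>UNIV. quad_char (x^2 - c)) = (if c = 0 then q - 1 else -1)"
    proof (cases "c = 0")
      case True
      have "(\<Sum>x\<in>UNIV. quad_char (x^2 :: 'a)) = (\<Sum>x\<in>UNIV - {0}. quad_char (x^2 :: 'a))"
        by (rule sum.mono_neutral_right) auto
      also have "\<dots> = (\<Sum>x\<in>UNIV - {0::'a}. 1)"
        by (rule sum.cong) (auto simp: quad_char_square)
      also have "\<dots> = q - 1" by (simp add: q_def card_Diff_singleton of_nat_diff)
      finally show ?thesis using True by simp
    qed (simp add: sum_quad_char_square_diff[OF two])
    finally show ?thesis by (simp add: algebra_simps)
  qed
  have "(\<Sum>x\<in>UNIV. \<Sum>y\<in>UNIV. F (x^2 + y^2))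
      = (\<Sum>x\<in>UNIV. \<Sum>c\<in>UNIV. (1 + quad_char (c - x^2)) * F c)"
  proof (rule sum.cong[OF refl])
    fix x :: 'a
    have "(\<Sum>y\<in>UNIV. F (x^2 + y^2)) = (\<Sum>c\<in>UNIV. (1 + quad_char c) * F (x^2 + c))"
      by (rule sum_squares_eq[OF two, of "\<lambda>c. F (x^2 + c)"])
    also have "\<dots> = (\<Sum>c\<in>UNIV. (1 + quad_char (c - x^2)) * F c)"
      using sum_UNIV_affine[of 1 "\<lambda>c. (1 + quad_char (c - x^2)) * F c" "x^2"]
      by (simp add: add.commute)
    finally show "(\<Sum>y\<in>UNIV. F (x^2 + y^2)) = (\<Sum>c\<in>UNIV. (1 + quad_char (c - x^2)) * F c)" .
  qed
  also have "\<dots> = (\<Sum>c\<in>UNIV. (\<Sum>x\<in>UNIV. 1 + quad_char (c - x^2)) * F c)"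
    by (subst sum.swap) (simp only: sum_distrib_right)
  also have "\<dots> = (\<Sum>c\<in>UNIV. (q - s) * F c + (if c = 0 then s * q * F 0 else 0))"
    unfolding count by (intro sum.cong refl) (simp add: algebra_simps)
  also have "\<dots> = (q - s) * (\<Sum>c\<in>UNIV. F c) + s * q * F 0"
    by (simp add: sum.distrib sum_distrib_left)
  finally show ?thesis .
qed

lemma sum_PiE_insert:
  assumes "i \<notin> I"
  shows "(\<Sum>y\<in>insert i I \<rightarrow>\<^sub>E A. G y) = (\<Sum>x\<in>A. \<Sum>y\<in>I \<rightarrow>\<^sub>E A. G (y(i := x)))"
proof -
  have "(\<Sum>y\<in>insert i I \<rightarrow>\<^sub>E A. G y) = (\<Sum>(x, y)\<in>A \<times> (I \<rightarrow>\<^sub>E A). G (y(i := x)))"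
    unfolding PiE_insert_eq
    using inj_combinator[OF assms, of "\<lambda>_. A"]
    by (subst sum.reindex) (auto simp: case_prod_unfold)
  then show ?thesis by (simp add: sum.cartesian_product)
qed

text \<open>The coefficient of the total sum is the number of vectors of any given nonzero norm; the
  zero norm is attained s^k q^k times more often. Induction removes two coordinates at a time and
  treats them with \<open>sum_two_squares\<close>.\<close>

lemma sum_even_squares:
  fixes F :: "'a::{field,finite} \<Rightarrow> real"
  assumes two: "(2::'a) \<noteq> 0" and "finite I" "card I = 2 * k"
  defines "q \<equiv> real CARD('a)" and "s \<equiv> quad_char (-1 :: 'a)"
  shows "(\<Sum>y\<in>I \<rightarrow>\<^sub>E UNIV. F (\<Sum>i\<in>I. (y i)^2))
    = (q^(2 * k) - s^k * q^k) / q * (\<Sum>c\<in>UNIV. F c) + s^k * q^k * F 0"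
  using assms(2,3)
proof (induction k arbitrary: I F)
  case 0
  then show ?case by simp
next
  case (Suc k)
  have q: "q > 0" by (simp add: q_def card_gt_0_iff)
  from Suc.prems obtain i where i: "i \<in> I" by fastforce
  define J where "J = I - {i}"
  have J: "finite J" "card J = Suc (2 * k)" using Suc.prems i by (auto simp: J_def)
  then obtain j where j: "j \<in> J" by fastforce
  define K where "K = J - {j}"
  have K: "finite K" "card K = 2 * k" using J j by (auto simp: K_def)
  have I: "I = insert i (insert j K)" and ij: "i \<notin> insert j K" "j \<notin> K"
    using i j by (auto simp: J_def K_def)
  have "(\<Sum>y\<in>I \<rightarrow>\<^sub>E UNIV. F (\<Sum>i\<in>I. (y i)^2))
      = (\<Sum>x\<in>UNIV. \<Sum>y\<in>UNIV. \<Sum>z\<in>K \<rightarrow>\<^sub>E UNIV. F (x^2 + y^2 + (\<Sum>i\<in>K. (z i)^2)))"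
  proof -
    have "(\<Sum>l\<in>I. (((z(j := y))(i := x)) l)^2) = x^2 + y^2 + (\<Sum>l\<in>K. (z l)^2)"
      for x y :: 'a and z
    proof -
      have "(\<Sum>l\<in>K. (((z(j := y))(i := x)) l)^2) = (\<Sum>l\<in>K. (z l)^2)"
        using ij by (intro sum.cong) auto
      then show ?thesis using ij K by (auto simp: I add.assoc)
    qed
    then show ?thesis
      by (simp only: I sum_PiE_insert[OF ij(1)] sum_PiE_insert[OF ij(2)])
  qed
  also have "\<dots> = (\<Sum>x\<in>UNIV. \<Sum>y\<in>UNIV. (q^(2 * k) - s^k * q^k) / q * (\<Sum>c\<in>UNIV. F c)
      + s^k * q^k * F (x^2 + y^2))"
  proof (intro sum.cong refl)
    \<comment> \<open>The induction hypothesis is applied to F translated by x^2 + y^2: the total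
      sum is unchanged, while the value at zero becomes F (x^2 + y^2).\<close>
    fix x y :: 'a
    show "(\<Sum>z\<in>K \<rightarrow>\<^sub>E UNIV. F (x^2 + y^2 + (\<Sum>i\<in>K. (z i)^2)))
      = (q^(2 * k) - s^k * q^k) / q * (\<Sum>c\<in>UNIV. F c) + s^k * q^k * F (x^2 + y^2)"
      using Suc.IH[OF K, of "\<lambda>c. F (x^2 + y^2 + c)"]
        sum_UNIV_affine[of 1 F "x^2 + y^2"] by (simp add: add.commute)
  qed
  also have "\<dots> = q^2 * ((q^(2 * k) - s^k * q^k) / q * (\<Sum>c\<in>UNIV. F c))
      + s^k * q^k * (\<Sum>x\<in>UNIV. \<Sum>y\<in>UNIV. F (x^2 + y^2))"
    by (simp add: sum.distrib sum_distrib_left power2_eq_square q_def)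
  also have "\<dots> = (q^(2 * Suc k) - s^Suc k * q^Suc k) / q * (\<Sum>c\<in>UNIV. F c)
      + s^Suc k * q^Suc k * F 0"
    unfolding sum_two_squares[OF two] q_def[symmetric] s_def[symmetric]
    using q by (simp add: field_simps power2_eq_square)
  finally show ?case .
qed

section \<open>Joint distribution of the two norms in the plane\<close>

text \<open>Take the coordinates s = x + e y along (1, e) and t = y - e x orthogonal to it. Then s^2
  + t^2 = d a and b = a - 2 s + d, so a and b determine s = (a + d - b) / 2, and t is any root of
  t^2 = d a - s^2. The weight of G a b is the number of such t.\<close>

lemma sum_two_norms:
  fixes G :: "'a::{field,finite} \<Rightarrow> 'a \<Rightarrow> real"
  assumes two: "(2::'a) \<noteq> 0" and d: "d = 1 + e^2" "d \<noteq> 0"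
  shows "(\<Sum>x\<in>UNIV. \<Sum>y\<in>UNIV. G (x^2 + y^2) ((x - 1)^2 + (y - e)^2))
    = (\<Sum>a\<in>UNIV. \<Sum>b\<in>UNIV.
        (1 + quad_char (-1 :: 'a) * quad_char ((a + d - b)^2 - 4 * d * a)) * G a b)"
proof -
  have "(\<Sum>x\<in>UNIV. \<Sum>y\<in>UNIV. G (x^2 + y^2) ((x - 1)^2 + (y - e)^2))
      = (\<Sum>(s, t)\<in>UNIV \<times> UNIV. G ((s^2 + t^2) / d) ((s^2 + t^2) / d - 2 * s + d))"
    unfolding sum.cartesian_product
  proof (rule sum.reindex_bij_witness[of _ "\<lambda>(s, t). ((s - e * t) / d, (e * s + t) / d)"
        "\<lambda>(x, y). (x + e * y, y - e * x)"], goal_cases)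
    case (1 z)
    obtain x y where z: "z = (x, y)" by force
    have "x + e * y - e * (y - e * x) = d * x" "e * (x + e * y) + (y - e * x) = d * y"
      by (simp_all add: d algebra_simps power2_eq_square)
    then show ?case using d(2) z by simp
  next
    case (3 z)
    obtain s t where z: "z = (s, t)" by force
    have "(s - e * t) + e * (e * s + t) = d * s" "(e * s + t) - e * (s - e * t) = d * t"
      by (simp_all add: d algebra_simps power2_eq_square)
    then show ?case using d(2) z
      by (simp add: add_divide_distrib[symmetric] diff_divide_distrib[symmetric])
  next
    case (5 z)
    obtain x y where z: "z = (x, y)" by force
    have "(x + e * y)^2 + (y - e * x)^2 = d * (x^2 + y^2)"
      by (simp add: d algebra_simps power2_eq_square)
    moreover have "(x - 1)^2 + (y - e)^2 = x^2 + y^2 - 2 * (x + e * y) + d"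
      by (simp add: d algebra_simps power2_eq_square)
    ultimately show ?case using d(2) z by simp
  qed auto
  also have "\<dots> = (\<Sum>s\<in>UNIV. \<Sum>t\<in>UNIV. G ((s^2 + t^2) / d) ((s^2 + t^2) / d - 2 * s + d))"
    by (simp add: sum.cartesian_product)
  also have "\<dots> = (\<Sum>s\<in>UNIV. \<Sum>a\<in>UNIV. (1 + quad_char (d * a - s^2)) * G a (a - 2 * s + d))"
  proof (rule sum.cong[OF refl])
    fix s :: 'a
    let ?H = "\<lambda>c. (1 + quad_char c) * G ((s^2 + c) / d) ((s^2 + c) / d - 2 * s + d)"
    have "(\<Sum>t\<in>UNIV. G ((s^2 + t^2) / d) ((s^2 + t^2) / d - 2 * s + d)) = (\<Sum>c\<in>UNIV. ?H c)"
      by (rule sum_squares_eq[OF two, of "\<lambda>c. G ((s^2 + c) / d) ((s^2 + c) / d - 2 * s + d)"])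
    \<comment> \<open>The substitution c = d a - s^2 makes (s^2 + c) / d equal to a.\<close>
    also have "\<dots> = (\<Sum>a\<in>UNIV. ?H (d * a + - (s^2)))"
      using sum_UNIV_affine[OF d(2), of ?H "- (s^2)"] by simp
    also have "\<dots> = (\<Sum>a\<in>UNIV. (1 + quad_char (d * a - s^2)) * G a (a - 2 * s + d))"
      using d(2) by simp
    finally show "(\<Sum>t\<in>UNIV. G ((s^2 + t^2) / d) ((s^2 + t^2) / d - 2 * s + d)) = \<dots>" .
  qed
  also have "\<dots> = (\<Sum>a\<in>UNIV. \<Sum>s\<in>UNIV. (1 + quad_char (d * a - s^2)) * G a (a - 2 * s + d))"
    by (rule sum.swap)
  also have "\<dots> = (\<Sum>a\<in>UNIV. \<Sum>b\<in>UNIV.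
        (1 + quad_char (-1 :: 'a) * quad_char ((a + d - b)^2 - 4 * d * a)) * G a b)"
  proof (rule sum.cong[OF refl])
    fix a :: 'a
    let ?H = "\<lambda>b. (1 + quad_char (-1 :: 'a) * quad_char ((a + d - b)^2 - 4 * d * a)) * G a b"
    \<comment> \<open>The square factor 2^2 leaves chi unchanged and clears the denominator of s =
      (a + d - b) / 2; the remaining sign gives chi(-1).\<close>
    have "quad_char (d * a - s^2)
        = quad_char (-1 :: 'a) * quad_char ((a + d - (-2 * s + (a + d)))^2 - 4 * d * a)" for s
    proof -
      have "quad_char (d * a - s^2) = quad_char (2^2 * (d * a - s^2))"
        by (rule quad_char_mult_square[OF two, symmetric])
      also have "2^2 * (d * a - s^2) = -1 * ((a + d - (-2 * s + (a + d)))^2 - 4 * d * a)"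
        by (simp add: algebra_simps power2_eq_square)
      finally show ?thesis by (simp only: quad_char_mult[OF two])
    qed
    then have "(\<Sum>s\<in>UNIV. (1 + quad_char (d * a - s^2)) * G a (a - 2 * s + d))
        = (\<Sum>s\<in>UNIV. ?H (-2 * s + (a + d)))"
      by (intro sum.cong refl arg_cong2[where f = "(*)"] arg_cong[where f = "G a"]) auto
    also have "\<dots> = (\<Sum>b\<in>UNIV. ?H b)"
      by (rule sum_UNIV_affine) (use two in simp)
    finally show "(\<Sum>s\<in>UNIV. (1 + quad_char (d * a - s^2)) * G a (a - 2 * s + d)) = \<dots>" .
  qed
  finally show ?thesis .
qed

section \<open>Restricting both norms to squares or zero\<close>

definition square_ind :: "'a::field \<Rightarrow> real" where
  "square_ind x = of_bool (x \<in> nonzero_squares \<union> {0})"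

text \<open>Every nonzero square has two roots but zero has only one, so twice the indicator is 1 +
  chi(c) plus a correction at c = 0; the correction is the extra f 0.\<close>

lemma sum_square_ind:
  fixes f :: "'a::{field,finite} \<Rightarrow> real"
  assumes two: "(2::'a) \<noteq> 0"
  shows "(\<Sum>c\<in>UNIV. square_ind c * f c) = ((\<Sum>x\<in>UNIV. f (x^2)) + f 0) / 2"
proof -
  have "2 * square_ind c = 1 + quad_char c + (if c = 0 then 1 else 0)" for c :: 'a
    by (auto simp: square_ind_def quad_char_def)
  then have "2 * (square_ind c * f c) = (1 + quad_char c) * f c + (if c = 0 then f 0 else 0)" for c
    by (simp add: mult.assoc[symmetric] distrib_right)
  then have "2 * (\<Sum>c\<in>UNIV. square_ind c * f c)
      = (\<Sum>c\<in>UNIV. (1 + quad_char c) * f c + (if c = 0 then f 0 else 0))"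
    by (simp add: sum_distrib_left)
  also have "\<dots> = (\<Sum>x\<in>UNIV. f (x^2)) + f 0"
    by (simp add: sum.distrib sum_squares_eq[OF two])
  finally show ?thesis by simp
qed

text \<open>Passing from squares a, b to roots x, z costs a factor 1/4 and adds boundary terms with
  x or z equal to zero. The sum over all roots decouples under u = x + z, w = x - z into (-1)^2 =
  1.\<close>

lemma sum_heron:
  fixes d :: "'a::{field,finite}"
  assumes two: "(2::'a) \<noteq> 0" and d: "d \<notin> nonzero_squares \<union> {0}"
  shows "(\<Sum>a\<in>UNIV. \<Sum>b\<in>UNIV. quad_char ((a + d - b)^2 - 4 * d * a) * (square_ind a * square_ind b))
    = (real CARD('a) + 1) / 2"
proof -
  define P where "P a b = quad_char ((a + d - b)^2 - 4 * d * a)" for a b :: 'a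
  have nz: "x^2 - d \<noteq> 0" for x
    using d by (cases "x = 0") (auto simp: nonzero_squares_def)
  \<comment> \<open>When one norm is zero the argument is the square of x^2 - d, which is nonzero
    because d is not a square; all boundary terms are therefore 1.\<close>
  have P0: "P (x^2) 0 = 1" "P 0 (x^2) = 1" for x
  proof -
    have "(x^2 + d - 0)^2 - 4 * d * x^2 = (x^2 - d)^2" "(0 + d - x^2)^2 - 4 * d * 0 = (x^2 - d)^2"
      by (simp_all add: algebra_simps power2_eq_square)
    then show "P (x^2) 0 = 1" "P 0 (x^2) = 1"
      unfolding P_def by (simp_all only: quad_char_square[OF nz])
  qed
  have "P (x^2) (z^2) = quad_char ((x + z)^2 - d) * quad_char ((x - z)^2 - d)" for x z
    unfolding P_def quad_char_mult[OF two, symmetric]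
    by (rule arg_cong[where f = quad_char]) (simp add: algebra_simps power2_eq_square)
  then have "(\<Sum>x\<in>UNIV. \<Sum>z\<in>UNIV. P (x^2) (z^2))
      = (\<Sum>(x, z)\<in>UNIV \<times> UNIV. quad_char ((x + z)^2 - d) * quad_char ((x - z)^2 - d))"
    by (simp add: sum.cartesian_product)
  also have "\<dots> = (\<Sum>(u, w)\<in>UNIV \<times> UNIV. quad_char (u^2 - d) * quad_char (w^2 - d))"
  proof -
    have "x + z + (x - z) = 2 * x" "x + z - (x - z) = 2 * z" for x z :: 'a by auto
    moreover have "(u + w) / 2 + (u - w) / 2 = u" "(u + w) / 2 - (u - w) / 2 = w" for u w :: 'a
      using two by (simp_all add: add_divide_distrib[symmetric] diff_divide_distrib[symmetric])
    ultimately show ?thesis using two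
      by (intro sum.reindex_bij_witness[of _ "\<lambda>(u, w). ((u + w) / 2, (u - w) / 2)"
            "\<lambda>(x, z). (x + z, x - z)"]) auto
  qed
  also have "\<dots> = (\<Sum>u\<in>UNIV. quad_char (u^2 - d)) * (\<Sum>w\<in>UNIV. quad_char (w^2 - d))"
    by (simp add: sum_product sum.cartesian_product)
  also have "\<dots> = 1" using sum_quad_char_square_diff[OF two, of d] d by simp
  finally have main: "(\<Sum>x\<in>UNIV. \<Sum>z\<in>UNIV. P (x^2) (z^2)) = 1" .
  have "(\<Sum>a\<in>UNIV. \<Sum>b\<in>UNIV. P a b * (square_ind a * square_ind b))
      = (\<Sum>a\<in>UNIV. square_ind a * (\<Sum>b\<in>UNIV. square_ind b * P a b))"
    by (simp add: sum_distrib_left mult_ac)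
  \<comment> \<open>The four pieces contribute 1, q, q and 1, giving (2 q + 2) / 4.\<close>
  also have "\<dots> = (((\<Sum>x\<in>UNIV. \<Sum>z\<in>UNIV. P (x^2) (z^2)) + (\<Sum>x\<in>UNIV. P (x^2) 0)) / 2
      + ((\<Sum>z\<in>UNIV. P 0 (z^2)) + P 0 0) / 2) / 2"
    unfolding sum_square_ind[OF two] sum_divide_distrib[symmetric] sum.distrib ..
  also have "\<dots> = (real CARD('a) + 1) / 2"
    using P0(1)[of 0] by (simp add: main P0 add_divide_distrib)
  finally show ?thesis by (simp add: P_def)
qed

text \<open>These are the two inputs for \<open>sum_even_squares\<close>: the value at c = 0 and the
  total over c, where c stands for the contribution of the remaining coordinates. Both contain the
  square of (q + 1) / 2, the number of squares including zero. The character term yields Heron's sum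
  at c = 0 and cancels in the total.\<close>

lemma sum_square_ind_two_norms:
  fixes e :: "'a::{field,finite}"
  assumes two: "(2::'a) \<noteq> 0" and d: "1 + e^2 \<notin> nonzero_squares \<union> {0}"
  defines "q \<equiv> real CARD('a)"
  shows "(\<Sum>x\<in>UNIV. \<Sum>y\<in>UNIV. square_ind (x^2 + y^2) * square_ind ((x - 1)^2 + (y - e)^2))
    = ((q + 1) / 2)^2 + quad_char (-1 :: 'a) * ((q + 1) / 2)" (is ?zero)
    and "(\<Sum>c\<in>UNIV. \<Sum>x\<in>UNIV. \<Sum>y\<in>UNIV.
      square_ind (x^2 + y^2 + c) * square_ind ((x - 1)^2 + (y - e)^2 + c))
    = q * ((q + 1) / 2)^2" (is ?total)
proof -
  define D where "D = 1 + e^2"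
  define w where "w a b = 1 + quad_char (-1 :: 'a) * quad_char ((a + D - b)^2 - 4 * D * a)"
    for a b :: 'a
  have D0: "D \<noteq> 0" using d by (auto simp: D_def)
  have total: "(\<Sum>a\<in>UNIV. \<Sum>b\<in>UNIV. square_ind (a::'a) * square_ind (b::'a)) = ((q + 1) / 2)^2"
  proof -
    have "(\<Sum>a\<in>UNIV. square_ind (a::'a)) = (q + 1) / 2"
      using sum_square_ind[OF two, of "\<lambda>_. 1"] by (simp add: q_def)
    then show ?thesis by (simp only: sum_product[symmetric] power2_eq_square)
  qed
  note norms = sum_two_norms[OF two D_def D0, folded w_def]
  have "(\<Sum>a\<in>UNIV. \<Sum>b\<in>UNIV. w a b * (square_ind a * square_ind b))
      = (\<Sum>a\<in>UNIV. \<Sum>b\<in>UNIV. square_ind (a::'a) * square_ind (b::'a)) + quad_char (-1 :: 'a) *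
        (\<Sum>a\<in>UNIV. \<Sum>b\<in>UNIV. quad_char ((a + D - b)^2 - 4 * D * a) * (square_ind a * square_ind b))"
    by (simp add: w_def distrib_right sum.distrib sum_distrib_left mult.assoc)
  then show ?zero
    unfolding norms[of "\<lambda>a b. square_ind a * square_ind b"]
    using sum_heron[OF two d[folded D_def]] by (simp only: total q_def)
  have "(\<Sum>c\<in>UNIV. \<Sum>x\<in>UNIV. \<Sum>y\<in>UNIV.
      square_ind (x^2 + y^2 + c) * square_ind ((x - 1)^2 + (y - e)^2 + c))
    = (\<Sum>c\<in>UNIV. \<Sum>a\<in>UNIV. \<Sum>b\<in>UNIV. w a b * (square_ind (a + c) * square_ind (b + c)))"
    by (intro sum.cong refl norms)
  also have "\<dots> = (\<Sum>c\<in>UNIV. \<Sum>a\<in>UNIV. \<Sum>b\<in>UNIV. w (a - c) (b - c) * (square_ind a * square_ind b))"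
  proof (rule sum.cong[OF refl])
    fix c :: 'a
    have "(\<Sum>a\<in>UNIV. \<Sum>b\<in>UNIV. w a b * (square_ind (a + c) * square_ind (b + c)))
        = (\<Sum>a\<in>UNIV. \<Sum>b\<in>UNIV. w a (b - c) * (square_ind (a + c) * square_ind b))"
      using sum_UNIV_affine[of 1 "\<lambda>b. w a (b - c) * (square_ind (a + c) * square_ind b)" c for a]
      by simp
    also have "\<dots> = (\<Sum>a\<in>UNIV. \<Sum>b\<in>UNIV. w (a - c) (b - c) * (square_ind a * square_ind b))"
      using sum_UNIV_affine[of 1
          "\<lambda>a. \<Sum>b\<in>UNIV. w (a - c) (b - c) * (square_ind a * square_ind b)" c] by simp
    finally show "(\<Sum>a\<in>UNIV. \<Sum>b\<in>UNIV. w a b * (square_ind (a + c) * square_ind (b + c))) = \<dots>" .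
  qed
  also have "\<dots> = (\<Sum>a\<in>UNIV. \<Sum>b\<in>UNIV. \<Sum>c\<in>UNIV. w (a - c) (b - c) * (square_ind a * square_ind b))"
    by (subst sum.swap, rule sum.cong[OF refl], rule sum.swap)
  also have "\<dots> = (\<Sum>a\<in>UNIV. \<Sum>b\<in>UNIV. q * (square_ind (a::'a) * square_ind (b::'a)))"
  proof (intro sum.cong refl)
    fix a b :: 'a
    \<comment> \<open>Shifting a and b by the same c preserves a - b, so the argument of the
      character is linear in c with slope 4 D. As this slope is nonzero, the character sum over c
      vanishes.\<close>
    have "(\<Sum>c\<in>UNIV. w (a - c) (b - c))
        = (\<Sum>c\<in>UNIV. 1 + quad_char (-1 :: 'a) *
            quad_char (4 * D * c + ((a + D - b)^2 - 4 * D * a)))"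
      unfolding w_def by (intro sum.cong refl) (simp add: algebra_simps)
    also have "\<dots> = q + quad_char (-1 :: 'a) *
        (\<Sum>c\<in>UNIV. quad_char (4 * D * c + ((a + D - b)^2 - 4 * D * a)))"
      by (simp add: sum.distrib sum_distrib_left q_def)
    also have "(\<Sum>c\<in>UNIV. quad_char (4 * D * c + ((a + D - b)^2 - 4 * D * a))) = 0"
    proof -
      have "(4::'a) = 2 * 2" by simp
      then have "4 * D \<noteq> 0" using two D0 by (metis mult_eq_0_iff)
      from sum_UNIV_affine[OF this, of quad_char] show ?thesis by (simp only: sum_quad_char[OF two])
    qed
    finally show "(\<Sum>c\<in>UNIV. w (a - c) (b - c) * (square_ind a * square_ind b))
        = q * (square_ind a * square_ind b)"
      by (simp add: sum_distrib_right[symmetric])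
  qed
  also have "\<dots> = q * ((q + 1) / 2)^2"
    unfolding total[symmetric] by (simp only: sum_distrib_left)
  finally show ?total .
qed

section \<open>The sign chi(-1) and the final count\<close>

text \<open>Translates the sign s of the character sums into the case distinction on q modulo
  4.\<close>

lemma quad_char_minus_one:
  assumes odd: "odd CARD('a::{field,finite})"
  shows "quad_char (-1 :: 'a) = (if CARD('a) mod 4 = 1 then 1 else -1)"
proof -
  note two = two_neq_zero_if_odd_card[OF odd]
  let ?S = "nonzero_squares :: 'a set"
  have "(-1::'a) \<noteq> 1" using two by (metis one_add_one add.right_inverse)
  have S1: "1 \<in> ?S" unfolding nonzero_squares_def by (auto intro!: exI[of _ 1])
  have "real CARD('a) = 1 + 2 * real (card ?S)"
  proof -
    have "(\<Sum>c\<in>UNIV. 2 * square_ind (c::'a)) = real CARD('a) + 1"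
      using sum_square_ind[OF two, of "\<lambda>_. 1"] by (simp add: sum_distrib_left[symmetric])
    moreover have "(\<Sum>c\<in>UNIV. square_ind (c::'a)) = real (card (?S \<union> {0}))"
      unfolding square_ind_def by (subst sum_of_bool_eq) (simp_all add: Un_def)
    moreover have "card (?S \<union> {0}) = Suc (card ?S)"
      by (simp add: nonzero_squares_def)
    ultimately show ?thesis by (simp add: sum_distrib_left[symmetric])
  qed
  then have card: "CARD('a) = 1 + 2 * card ?S" by linarith
  \<comment> \<open>Inversion acts on the nonzero squares, and its only possible fixed points are \<open>\<plusminus>1\<close>.\<close>
  have "even (card (?S - {1, -1}))"
  proof (rule even_card_involution[where f = inverse])
    fix x assume x: "x \<in> ?S - {1, -1}"
    then obtain y where y: "x = y^2" "y \<noteq> 0" by (auto simp: nonzero_squares_def)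
    then have "inverse x = (inverse y)^2" "inverse y \<noteq> 0" by (auto simp: power_inverse)
    then have "inverse x \<in> ?S" unfolding nonzero_squares_def by blast
    moreover have "inverse x \<noteq> x"
    proof
      assume "inverse x = x"
      then have "x^2 = 1" using y by (metis power2_eq_square right_inverse power_not_zero)
      then show False using x by (simp add: power2_eq_1_iff)
    qed
    moreover have "inverse x \<noteq> 1" "inverse x \<noteq> -1"
      using x by (auto simp: inverse_eq_iff_eq[of x "-1", simplified])
    ultimately show "inverse x \<in> ?S - {1, -1} \<and> inverse (inverse x) = x \<and> inverse x \<noteq> x"
      by simp
  qed simp
  \<comment> \<open>The removed part has two elements or one according to whether -1 is a square, so
    the parity of \<open>card ?S\<close> decides this. Since q = 1 + 2 \<open>card ?S\<close>, that
    parity is read off from q modulo 4.\<close>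
  moreover have "card ?S = card (?S - {1, -1}) + card (?S \<inter> {1, -1})"
    by (metis card_Int_Diff finite add.commute)
  moreover have "card (?S \<inter> {1, -1}) = (if -1 \<in> ?S then 2 else 1)"
    using S1 \<open>-1 \<noteq> 1\<close> by (auto simp: Int_insert_right)
  ultimately have "even (card ?S) \<longleftrightarrow> -1 \<in> ?S" by auto
  moreover have "even (card ?S) \<longleftrightarrow> CARD('a) mod 4 = 1"
    unfolding card by presburger
  ultimately show ?thesis by (simp add: quad_char_def)
qed

theorem theorem3p1:
  fixes \<epsilon> :: "'a::{field,finite}" and q m :: nat
  assumes "q = CARD('a)" and "odd q"
    and "1 + \<epsilon>^2 \<notin> nonzero_squares \<union> {0}"
    and "m \<ge> 4" and "even m"
  shows "real (card {y \<in> {1..m} \<rightarrow>\<^sub>E (UNIV :: 'a set).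
             (\<Sum>i=1..m. (y i)^2) \<in> nonzero_squares \<union> {0} \<and>
             (y 1 - 1)^2 + (y 2 - \<epsilon>)^2 + (\<Sum>i=3..m. (y i)^2) \<in> nonzero_squares \<union> {0}})
         = (if q mod 4 = 1
            then 1/4 * real q ^ (m div 2 - 1) * (real q + 1)
                   * (real q ^ (m div 2) + real q ^ (m div 2 - 1) + 2)
            else 1/4 * real q ^ (m div 2 - 1) * (real q + 1)
                   * (real q ^ (m div 2) + real q ^ (m div 2 - 1) + 2 * (-1) ^ (m div 2)))"
proof -
  have odd: "odd CARD('a)" using assms by simp
  note two = two_neq_zero_if_odd_card[OF odd]
  \<comment> \<open>The coordinates 3 to m form k pairs.\<close>
  define k where "k = m div 2 - 1"
  have m: "m = 2 * k + 2" "m div 2 = Suc k" using assms(4,5) by (auto simp: k_def)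
  define s where "s = quad_char (-1 :: 'a)"
  define r where "r = real q"
  have r: "r > 0" using odd assms(1) by (auto simp: r_def intro!: odd_pos)
  let ?g = "square_ind :: 'a \<Rightarrow> real"
  let ?I = "{3..m}"
  define F where "F x y c = ?g (x^2 + y^2 + c) * ?g ((x - 1)^2 + (y - \<epsilon>)^2 + c)" for x y c
  define \<alpha> where "\<alpha> = (r^(2 * k) - s^k * r^k) / r"
  have I: "{1..m} = insert 1 (insert 2 ?I)" using m by auto
  have "real (card {y \<in> {1..m} \<rightarrow>\<^sub>E (UNIV :: 'a set).
             (\<Sum>i=1..m. (y i)^2) \<in> nonzero_squares \<union> {0} \<and>
             (y 1 - 1)^2 + (y 2 - \<epsilon>)^2 + (\<Sum>i=3..m. (y i)^2) \<in> nonzero_squares \<union> {0}})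
      = (\<Sum>y\<in>{1..m} \<rightarrow>\<^sub>E UNIV. ?g (\<Sum>i=1..m. (y i)^2)
          * ?g ((y 1 - 1)^2 + (y 2 - \<epsilon>)^2 + (\<Sum>i\<in>?I. (y i)^2)))"
    by (simp add: square_ind_def of_bool_conj[symmetric] finite_PiE Int_def
        del: of_bool_conj Un_iff insert_iff)
  also have "\<dots> = (\<Sum>y\<in>{1..m} \<rightarrow>\<^sub>E UNIV. F (y 1) (y 2) (\<Sum>i\<in>?I. (y i)^2))"
    unfolding F_def I by (simp add: add.assoc)
  also have "\<dots> = (\<Sum>x\<in>UNIV. \<Sum>y\<in>UNIV. \<Sum>z\<in>?I \<rightarrow>\<^sub>E UNIV. F x y (\<Sum>i\<in>?I. (z i)^2))"
  proof -
    have "(\<Sum>i\<in>?I. (((z(2 := y))(1 := x)) i)^2) = (\<Sum>i\<in>?I. (z i)^2)" for x y :: 'a and z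
      by (intro sum.cong) auto
    then show ?thesis unfolding I by (simp add: sum_PiE_insert)
  qed
  \<comment> \<open>For fixed x and y, both norms depend on the other 2 k coordinates only through
    their sum of squares c.\<close>
  also have "\<dots> = (\<Sum>x\<in>UNIV. \<Sum>y\<in>UNIV. \<alpha> * (\<Sum>c\<in>UNIV. F x y c) + s^k * r^k * F x y 0)"
    unfolding \<alpha>_def s_def r_def assms(1)
    by (intro sum.cong refl sum_even_squares[OF two]) (use m in auto)
  also have "\<dots> = \<alpha> * (\<Sum>x\<in>UNIV. \<Sum>y\<in>UNIV. \<Sum>c\<in>UNIV. F x y c)
      + s^k * r^k * (\<Sum>x\<in>UNIV. \<Sum>y\<in>UNIV. F x y 0)"
    by (simp only: sum.distrib sum_distrib_left)
  also have "(\<Sum>x\<in>UNIV. \<Sum>y\<in>UNIV. \<Sum>c\<in>UNIV. F x y c) = (\<Sum>x\<in>UNIV. \<Sum>c\<in>UNIV. \<Sum>y\<in>UNIV. F x y c)"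
    by (rule sum.cong[OF refl], rule sum.swap)
  also have "\<dots> = (\<Sum>c\<in>UNIV. \<Sum>x\<in>UNIV. \<Sum>y\<in>UNIV. F x y c)"
    by (rule sum.swap)
  also have "\<dots> = r * ((r + 1) / 2)^2"
    unfolding F_def r_def assms(1) by (rule sum_square_ind_two_norms(2)[OF two assms(3)])
  also have "(\<Sum>x\<in>UNIV. \<Sum>y\<in>UNIV. F x y 0) = ((r + 1) / 2)^2 + s * ((r + 1) / 2)"
    unfolding F_def r_def s_def assms(1) add_0_right
    by (rule sum_square_ind_two_norms(1)[OF two assms(3)])
  \<comment> \<open>Because \<alpha> r = r^(2 k) - s^k r^k, the two terms s^k r^k ((r + 1) / 2)^2
    cancel, and s survives only in the power s^(k + 1) = s^(m / 2).\<close>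
  also have "\<alpha> * (r * ((r + 1) / 2)^2) + s^k * r^k * (((r + 1) / 2)^2 + s * ((r + 1) / 2))
      = 1/4 * r^k * (r + 1) * (r^Suc k + r^k + 2 * s^Suc k)"
  proof -
    have "\<alpha> * r = r^k * r^k - s^k * r^k"
      using r by (simp add: \<alpha>_def mult_2 power_add)
    then have "\<alpha> * (r * ((r + 1) / 2)^2) = (r^k * r^k - s^k * r^k) * ((r + 1) / 2)^2"
      by (simp only: mult.assoc[symmetric])
    then show ?thesis by (simp add: field_simps power2_eq_square)
  qed
  finally show ?thesis
    using quad_char_minus_one[OF odd] m assms(1) by (simp add: r_def s_def k_def[symmetric])
qed

end
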